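(* Let $0<\alpha<1/2$ and $p=n^{-\alpha}$. There is a constant $c=c(\alpha)$, depending only on $\alpha$, such that \[ \mathbb{P}\big(D(H_n,H_{n,p})<c\big)\to 1 \quad\text{as } n\to\infty . \]
   Context: $H_n$ is the hypercube graph with vertex set $\{0,1\}^n$, two vectors being adjacent iff they differ in exactly one coordinate. $H_{n,p}$ is the random subgraph of $H_n$ obtained by Bernoulli bond percolation: it has the same vertex set, and each edge of $H_n$ is kept (is "open") independently with probability $p$. Every graph is regarded as a metric space on its vertex set with the graph (shortest-path) distance; vertices in different connected components are at distance $+\infty$. For a map $f:X\to Y$ between metric spaces, $D(f)=D_+(f)/D_-(f)$ where $D_+(f)=\max\{1,\sup_{a\neq b\in X} d_Y(f(a),f(b))/d_X(a,b)\}$ and $D_-(f)=\inf_{a\neq b\in X}\max\{1,d_Y(f(a),f(b))\}/d_X(a,b)$ (maps need not be injective or surjective). The metric distortion is $D(X,Y)=\inf_{f:X\to Y}D(f)$. *)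

theory Defs
  imports "HOL-Analysis.Analysis" "HOL-Library.Extended_Real"
begin

text \<open>Vertices of the hypercube H_n: subsets of {0..<n} (identified with
  0/1-vectors of length n via indicator functions).\<close>
definition hc_vertices :: "nat \<Rightarrow> nat set set" where
  "hc_vertices n = Pow {..<n}"

definition hc_edges :: "nat \<Rightarrow> nat set set set" where
  "hc_edges n = {{x, y} | x y. x \<in> hc_vertices n \<and> y \<in> hc_vertices n \<and>
                   card ((x - y) \<union> (y - x)) = 1}"

text \<open>Shortest-path distance in the graph with edge set S (walks use only
  edges of S); infinity if there is no path.\<close>
definition walk_from_to :: "'v set set \<Rightarrow> 'v \<Rightarrow> 'v \<Rightarrow> 'v list \<Rightarrow> bool" where
  "walk_from_to S x y xs \<longleftrightarrow> xs \<noteq> [] \<and> hd xs = x \<and> last xs = y \<and>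
     (\<forall>i. Suc i < length xs \<longrightarrow> {xs ! i, xs ! Suc i} \<in> S)"

definition gdist :: "'v set set \<Rightarrow> 'v \<Rightarrow> 'v \<Rightarrow> enat" where
  "gdist S x y = (INF xs \<in> {xs. walk_from_to S x y xs}. enat (length xs - 1))"

text \<open>Distortion of a map f from (V, dX) to (V, dY). D_+ and D_- as in the paper,
  in the extended reals. If D_+ = \<infinity> (some pair is mapped to different components)
  the distortion is \<infinity>.\<close>
definition dist_plus :: "'v set \<Rightarrow> ('v \<Rightarrow> 'v \<Rightarrow> enat) \<Rightarrow> ('v \<Rightarrow> 'v \<Rightarrow> enat) \<Rightarrow> ('v \<Rightarrow> 'v) \<Rightarrow> ereal" where
  "dist_plus X dX dY f =
     max 1 (SUP (a, b) \<in> {(a, b). a \<in> X \<and> b \<in> X \<and> a \<noteq> b}.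
              ereal_of_enat (dY (f a) (f b)) / ereal_of_enat (dX a b))"

definition dist_minus :: "'v set \<Rightarrow> ('v \<Rightarrow> 'v \<Rightarrow> enat) \<Rightarrow> ('v \<Rightarrow> 'v \<Rightarrow> enat) \<Rightarrow> ('v \<Rightarrow> 'v) \<Rightarrow> ereal" where
  "dist_minus X dX dY f =
     (INF (a, b) \<in> {(a, b). a \<in> X \<and> b \<in> X \<and> a \<noteq> b}.
              max 1 (ereal_of_enat (dY (f a) (f b))) / ereal_of_enat (dX a b))"

definition map_distortion :: "'v set \<Rightarrow> ('v \<Rightarrow> 'v \<Rightarrow> enat) \<Rightarrow> ('v \<Rightarrow> 'v \<Rightarrow> enat) \<Rightarrow> ('v \<Rightarrow> 'v) \<Rightarrow> ereal" where
  "map_distortion X dX dY f =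
     (if dist_plus X dX dY f = \<infinity> then \<infinity> else dist_plus X dX dY f / dist_minus X dX dY f)"

definition hc_distortion :: "nat \<Rightarrow> nat set set set \<Rightarrow> ereal" where
  "hc_distortion n S =
     (INF f \<in> {f. f ` hc_vertices n \<subseteq> hc_vertices n}.
        map_distortion (hc_vertices n) (gdist (hc_edges n)) (gdist S) f)"

definition perc_prob :: "nat \<Rightarrow> real \<Rightarrow> nat set set set set \<Rightarrow> real" where
  "perc_prob n p A =
     (\<Sum>S \<in> Pow (hc_edges n) \<inter> A. p ^ card S * (1 - p) ^ (card (hc_edges n) - card S))"

end

theory Submission
  imports Defs "HOL-Real_Asymp.Real_Asymp"
begin

text \<open>
  Call an edge 0-good if it is open, and \<open>{u, u + e\<^sub>i}\<close> \<open>(t+1)\<close>-good if for some direction \<open>j\<close> of a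
  class \<open>C\<^sub>t\<close> both \<open>{u, u + e\<^sub>j}\<close> and \<open>{u + e\<^sub>i, u + e\<^sub>i + e\<^sub>j}\<close> are open and
  \<open>{u + e\<^sub>j, u + e\<^sub>i + e\<^sub>j}\<close> is \<open>t\<close>-good; the ends of a \<open>t\<close>-good edge are joined by an open path of length
  \<open>2 t + 1\<close>. If the classes are disjoint, the candidates for \<open>j\<close> depend on disjoint sets of edges, so
  with classes of size of order \<open>n\<close> the probability \<open>q\<^sub>t\<close> of being \<open>t\<close>-good satisfies
  \<open>q\<^sub>t\<^sub>+\<^sub>1 \<ge> 1 - (1 - p\<^sup>2 q\<^sub>t)\<^sup>m\<close>. As \<open>n p\<^sup>2 = n\<^bsup>1 - 2 \<alpha>\<^esup>\<close> is a positive power of \<open>n\<close>, after boundedly many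
  steps an edge fails to be \<open>N\<close>-good with probability at most \<open>\<delta> = exp (- n\<^bsup>\<epsilon>\<^esup>)\<close>.

  This does not beat the \<open>2\<^sup>n\<close> vertices, but two further classes of directions amplify it. Let \<open>f x\<close>
  be a neighbour \<open>x + e\<^sub>k\<close>, with \<open>k\<close> in the class \<open>C\<^sub>N\<^sub>+\<^sub>1\<close>, all of whose edges in the directions of
  \<open>C\<^sub>N\<close> are \<open>N\<close>-good; it fails to exist with probability at most \<open>(n \<delta>)\<^bsup>|C\<^sub>N\<^sub>+\<^sub>1|\<^esup>\<close>. For adjacent \<open>x\<close> and \<open>y\<close>
  a path of length 3 leads from \<open>f x\<close> to \<open>f y\<close>, and some translate of it by \<open>e\<^sub>j\<close>, \<open>j \<in> C\<^sub>N\<close>, consists of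
  \<open>N\<close>-good edges, except with probability at most \<open>(3 \<delta>)\<^bsup>|C\<^sub>N| - 3\<^esup>\<close>. Both bounds are \<open>o(2\<^bsup>-n\<^esup>)\<close>, so with high
  probability \<open>f\<close> moves every point by at most 1 and is Lipschitz with constant \<open>5 (2 N + 1)\<close>.
\<close>

subsection \<open>Bernoulli percolation on a finite set\<close>

text \<open>The ground set is arbitrary because \<open>bern_split\<close> factors the measure into
  percolation on \<open>E \<inter> F\<close> and on \<open>E - F\<close>.\<close>

definition bern :: "'e set \<Rightarrow> real \<Rightarrow> 'e set set \<Rightarrow> real" where
  "bern E p A = (\<Sum>S \<in> Pow E \<inter> A. p ^ card S * (1 - p) ^ (card E - card S))"

lemma perc_prob_eq_bern: "perc_prob n p A = bern (hc_edges n) p A"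
  by (simp add: perc_prob_def bern_def)

text \<open>Membership is decided by the states of the elements of \<open>F\<close>. Disjointness of
  supports is the criterion for independence throughout.\<close>

definition supported :: "'e set \<Rightarrow> 'e set set \<Rightarrow> bool" where
  "supported F A \<longleftrightarrow> (\<forall>S. S \<inter> F \<in> A \<longleftrightarrow> S \<in> A)"

lemma supportedD: "supported F A \<Longrightarrow> S \<inter> F \<in> A \<longleftrightarrow> S \<in> A"
  by (simp add: supported_def)

lemma supported_mono:
  assumes "supported F A" "F \<subseteq> G"
  shows "supported G A"
proof -
  have "(S \<inter> G) \<inter> F = S \<inter> F" for S using assms(2) by auto
  then show ?thesis using assms(1) unfolding supported_def by metis
qed

lemma supported_UNIV [simp]: "supported F UNIV"
  by (simp add: supported_def)

lemma supported_Compl: "supported F A \<Longrightarrow> supported F (- A)"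
  by (simp add: supported_def)

lemma supported_Int: "supported F A \<Longrightarrow> supported F B \<Longrightarrow> supported F (A \<inter> B)"
  by (simp add: supported_def)

lemma supported_INT: "(\<And>i. i \<in> I \<Longrightarrow> supported F (A i)) \<Longrightarrow> supported F (\<Inter>i\<in>I. A i)"
  by (simp add: supported_def)

lemma supported_UN: "(\<And>i. i \<in> I \<Longrightarrow> supported F (A i)) \<Longrightarrow> supported F (\<Union>i\<in>I. A i)"
  by (simp add: supported_def)

lemma supported_mem: "e \<in> F \<Longrightarrow> supported F {S. e \<in> S}"
  by (simp add: supported_def)

context
  fixes E :: "'e set" and p :: real
  assumes finE: "finite E" and p01: "0 \<le> p" "p \<le> 1"
begin

lemma bern_weight_nonneg: "0 \<le> p ^ card S * (1 - p) ^ (card E - card S)"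
  using p01 by simp

lemma bern_nonneg: "0 \<le> bern E p A"
  unfolding bern_def by (intro sum_nonneg bern_weight_nonneg)

lemma bern_mono:
  assumes "\<And>S. S \<subseteq> E \<Longrightarrow> S \<in> A \<Longrightarrow> S \<in> B"
  shows "bern E p A \<le> bern E p B"
  unfolding bern_def using finE p01 assms
  by (intro sum_mono2) auto

lemma bern_UNIV: "bern E p UNIV = 1"
proof -
  have "(p + (1 - p)) ^ card E = (\<Prod>x\<in>E. p + (1 - p))" by simp
  also have "\<dots> = (\<Sum>S\<in>Pow E. (\<Prod>x\<in>S. p) * (\<Prod>x\<in>E - S. 1 - p))"
    by (rule prod_add[OF finE])
  also have "\<dots> = bern E p UNIV"
    unfolding bern_def
    by (intro sum.cong) (auto simp: card_Diff_subset finite_subset[OF _ finE])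
  finally show ?thesis by simp
qed

lemma bern_Compl: "bern E p (- A) = 1 - bern E p A"
proof -
  have "bern E p UNIV = bern E p A + bern E p (- A)"
    unfolding bern_def using finE
    by (subst sum.union_disjoint[symmetric]) (auto intro: sum.cong)
  then show ?thesis by (simp add: bern_UNIV)
qed

lemma bern_le_1: "bern E p A \<le> 1"
  using bern_Compl[of A] bern_nonneg[of "- A"] by simp

lemma bern_Un_le: "bern E p (A \<union> B) \<le> bern E p A + bern E p B"
proof -
  have "bern E p (A \<union> B) + (\<Sum>S \<in> (Pow E \<inter> A) \<inter> (Pow E \<inter> B). p ^ card S * (1 - p) ^ (card E - card S))
      = bern E p A + bern E p B"
    unfolding bern_def Int_Un_distrib
    using finE by (subst sum.union_inter) auto
  moreover have "0 \<le> (\<Sum>S \<in> (Pow E \<inter> A) \<inter> (Pow E \<inter> B). p ^ card S * (1 - p) ^ (card E - card S))"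
    by (intro sum_nonneg bern_weight_nonneg)
  ultimately show ?thesis by linarith
qed

lemma bern_UN_le:
  fixes r :: real
  assumes "finite I" "\<And>i. i \<in> I \<Longrightarrow> bern E p (A i) \<le> r"
  shows "bern E p (\<Union>i\<in>I. A i) \<le> real (card I) * r"
  using assms
proof (induction I rule: finite_induct)
  case (insert i I)
  have "bern E p (\<Union>i\<in>insert i I. A i) \<le> bern E p (A i) + bern E p (\<Union>i\<in>I. A i)"
    using bern_Un_le by simp
  also have "\<dots> \<le> r + real (card I) * r" using insert by (intro add_mono) auto
  finally show ?case using insert by (simp add: algebra_simps)
qed (simp add: bern_def)

end

text \<open>Sending \<open>S\<close> to \<open>(S \<inter> F, S - F)\<close> is a bijection onto
  pairs under which the weights factor. The event \<open>B\<close> does not see the part inside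
  \<open>F\<close>, because its support misses \<open>F\<close>.\<close>

lemma bern_split:
  assumes "finite E" "supported F A" "supported G B" "F \<inter> G = {}"
  shows "bern E p (A \<inter> B) = bern (E \<inter> F) p A * bern (E - F) p B"
proof -
  let ?w = "\<lambda>E S. p ^ card S * (1 - p) ^ (card E - card S)"
  have fin: "finite (E \<inter> F)" "finite (E - F)" using assms(1) by auto
  have cE: "card E = card (E \<inter> F) + card (E - F)"
    using fin by (subst card_Un_disjoint[symmetric]) (auto intro: arg_cong[where f=card])
  have "bern (E \<inter> F) p A * bern (E - F) p B
      = (\<Sum>(S, T) \<in> (Pow (E \<inter> F) \<inter> A) \<times> (Pow (E - F) \<inter> B). ?w (E \<inter> F) S * ?w (E - F) T)"
    unfolding bern_def by (simp add: sum_product sum.cartesian_product)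
  also have "\<dots> = bern E p (A \<inter> B)"
    unfolding bern_def
  proof (rule sum.reindex_bij_witness
      [where i = "\<lambda>S. (S \<inter> F, S - F)" and j = "\<lambda>(S, T). S \<union> T"], goal_cases)
    case (1 a)
    then show ?case by auto
  next
    case (2 a)
    then obtain S T where a: "a = (S, T)" "S \<subseteq> E \<inter> F" "T \<subseteq> E - F" "S \<in> A" "T \<in> B" by auto
    have e: "(S \<union> T) \<inter> F = S" using a by auto
    have "(S \<union> T) \<inter> G = T \<inter> G" using a assms(4) by auto
    then have "S \<union> T \<in> A" "S \<union> T \<in> B"
      using supportedD[OF assms(2), of "S \<union> T"] supportedD[OF assms(3), of "S \<union> T"]
        supportedD[OF assms(3), of "T"] a e by auto
    then show ?case using a by auto
  next
    case (3 b)
    then show ?case by auto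
  next
    case (4 b)
    have "(b - F) \<inter> G = b \<inter> G" using assms(4) by auto
    then have "b \<inter> F \<in> A" "b - F \<in> B"
      using 4 supportedD[OF assms(2), of b] supportedD[OF assms(3), of b]
        supportedD[OF assms(3), of "b - F"] by auto
    then show ?case using 4 by auto
  next
    case (5 a)
    then obtain S T where a: "a = (S, T)" "S \<subseteq> E \<inter> F" "T \<subseteq> E - F" by auto
    have fST: "finite S" "finite T" using finite_subset[OF a(2) fin(1)] finite_subset[OF a(3) fin(2)] .
    have c: "card (S \<union> T) = card S + card T" using a fST by (intro card_Un_disjoint) auto
    \<comment> \<open>These bounds make the truncated subtractions of the exponents
      additive.\<close>
    have "card S \<le> card (E \<inter> F)" "card T \<le> card (E - F)" using a fin by (auto intro: card_mono)
    then have "card E - card (S \<union> T) = (card (E \<inter> F) - card S) + (card (E - F) - card T)"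
      using c cE by linarith
    then show ?case by (simp add: a c power_add)
  qed
  finally show ?thesis by simp
qed

text \<open>Two further splittings along \<open>F\<close>, with \<open>UNIV\<close> in place of
  \<open>B\<close> and then of \<open>A\<close>, identify the two factors of
  \<open>bern_split\<close> as the full probabilities of \<open>A\<close> and
  \<open>B\<close>.\<close>

lemma bern_indep:
  assumes "finite E" "0 \<le> p" "p \<le> 1" "supported F A" "supported G B" "F \<inter> G = {}"
  shows "bern E p (A \<inter> B) = bern E p A * bern E p B"
proof -
  have "bern E p A = bern (E \<inter> F) p A * bern (E - F) p UNIV"
    using bern_split[OF assms(1,4) supported_UNIV[of "{}"], of p] by simp
  moreover have "bern E p B = bern (E \<inter> F) p UNIV * bern (E - F) p B"
    using bern_split[OF assms(1) supported_UNIV assms(5,6), of p] by simp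
  ultimately show ?thesis
    using bern_split[OF assms(1,4,5,6), of p] assms(1-3) by (simp add: bern_UNIV)
qed

lemma bern_mem:
  assumes "finite E" "0 \<le> p" "p \<le> 1" "e \<in> E"
  shows "bern E p {S. e \<in> S} = p"
proof -
  have "bern E p {S. e \<in> S} = bern (E \<inter> {e}) p {S. e \<in> S} * bern (E - {e}) p UNIV"
    using bern_split[OF assms(1) supported_mem[of e "{e}"] supported_UNIV[of "{}"], of p] by simp
  also have "\<dots> = bern {e} p {S. e \<in> S}" using assms by (simp add: bern_UNIV)
  also have "Pow {e} \<inter> {S. e \<in> S} = {{e}}" by auto
  then have "bern {e} p {S. e \<in> S} = p" by (simp add: bern_def)
  finally show ?thesis .
qed

text \<open>The failures are independent: the support of a new index misses the union of the other
  supports, on which their joint failure is supported.\<close>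

lemma bern_none_le:
  assumes "finite E" "0 \<le> p" "p \<le> 1" "finite I"
    and "\<And>i. i \<in> I \<Longrightarrow> supported (F i) (A i)"
    and "disjoint_family_on F I"
    and "\<And>i. i \<in> I \<Longrightarrow> bern E p (- A i) \<le> r" and "0 \<le> r"
  shows "bern E p (\<Inter>i\<in>I. - A i) \<le> r ^ card I"
  using assms(4-8)
proof (induction I rule: finite_induct)
  case empty
  then show ?case using bern_UNIV[OF assms(1-3)] by simp
next
  case (insert i I)
  have "F i \<inter> (\<Union>j\<in>I. F j) = {}"
    using insert.hyps insert.prems(2) by (fastforce simp: disjoint_family_on_def)
  moreover have "supported (\<Union>j\<in>I. F j) (\<Inter>j\<in>I. - A j)"
    using insert.prems(1) by (intro supported_INT supported_Compl supported_mono[OF _ UN_upper]) auto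
  ultimately have "bern E p (- A i \<inter> (\<Inter>j\<in>I. - A j)) = bern E p (- A i) * bern E p (\<Inter>j\<in>I. - A j)"
    using insert.prems(1) by (intro bern_indep[OF assms(1-3)] supported_Compl) auto
  also have "\<dots> \<le> r * r ^ card I"
  proof (intro mult_mono bern_nonneg[OF assms(1-3)] insert.IH)
    show "disjoint_family_on F I"
      using insert.prems(2) by (auto simp: disjoint_family_on_def)
  qed (use insert.prems in auto)
  finally show ?case using insert.hyps by simp
qed

subsection \<open>Graph distance\<close>

lemma walk_from_to_iff_successively:
  "walk_from_to S x y xs \<longleftrightarrow>
     xs \<noteq> [] \<and> hd xs = x \<and> last xs = y \<and> successively (\<lambda>a b. {a, b} \<in> S) xs"
  by (simp add: walk_from_to_def successively_conv_nth)

lemma gdist_le: "walk_from_to S x y xs \<Longrightarrow> gdist S x y \<le> enat (length xs - 1)"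
  unfolding gdist_def by (auto intro: INF_lower2)

text \<open>A finite infimum of extended naturals is attained, so a shortest walk exists; if there
  were no walk, the infimum would be infinite.\<close>

lemma gdist_eq_enatE:
  assumes "gdist S x y = enat k"
  obtains xs where "walk_from_to S x y xs" "length xs = Suc k"
proof -
  let ?M = "(\<lambda>xs. enat (length xs - 1)) ` {xs. walk_from_to S x y xs}"
  have ne: "?M \<noteq> {}"
  proof
    assume "?M = {}"
    then have "Inf ?M = \<infinity>" by (simp add: top_enat_def)
    then show False using assms by (simp add: gdist_def)
  qed
  then have "Inf ?M \<in> ?M"
    using LeastI_ex[of "\<lambda>x. x \<in> ?M"] by (simp only: Inf_enat_def if_False) blast
  then obtain xs where xs: "walk_from_to S x y xs" "enat k = enat (length xs - 1)"
    using assms by (auto simp: gdist_def)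
  then have "xs \<noteq> []" by (simp add: walk_from_to_def)
  then show thesis using xs by (intro that[of xs]) (auto simp: Suc_diff_1 length_greater_0_conv)
qed

lemma gdist_refl [simp]: "gdist S x x = 0"
  using gdist_le[of S x x "[x]"] by (simp add: walk_from_to_def zero_enat_def[symmetric])

lemma gdist_edge: "{x, y} \<in> S \<Longrightarrow> gdist S x y \<le> 1"
  using gdist_le[of S x y "[x, y]"] by (simp add: walk_from_to_iff_successively one_enat_def)

lemma gdist_triangle: "gdist S x z \<le> gdist S x y + gdist S y z"
proof (cases "gdist S x y"; cases "gdist S y z")
  fix k l assume kl: "gdist S x y = enat k" "gdist S y z = enat l"
  obtain xs where xs: "walk_from_to S x y xs" "length xs = Suc k" using gdist_eq_enatE[OF kl(1)] .
  obtain ys where ys: "walk_from_to S y z ys" "length ys = Suc l" using gdist_eq_enatE[OF kl(2)] .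
  obtain zs where zs: "ys = y # zs" using ys(1) by (cases ys) (auto simp: walk_from_to_def)
  have "walk_from_to S x z (xs @ zs)"
    using xs(1) ys(1) unfolding zs walk_from_to_iff_successively
    by (auto simp: successively_append_iff successively_Cons)
  from gdist_le[OF this] show ?thesis using kl xs(2) ys(2) by (simp add: zs)
qed auto

lemma gdist_triangle_le: "gdist S x y \<le> a \<Longrightarrow> gdist S y z \<le> b \<Longrightarrow> gdist S x z \<le> a + b"
  using gdist_triangle by (meson add_mono order_trans)

lemma gdist_sym_le: "gdist S y x \<le> gdist S x y"
proof (cases "gdist S x y")
  case (enat k)
  then obtain xs where xs: "walk_from_to S x y xs" "length xs = Suc k" by (rule gdist_eq_enatE)
  then have "walk_from_to S y x (rev xs)"
    by (auto simp: walk_from_to_iff_successively hd_rev last_rev insert_commute)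
  from gdist_le[OF this] show ?thesis using enat xs(2) by simp
qed auto

lemma gdist_sym: "gdist S y x = gdist S x y"
  using gdist_sym_le by (metis order_antisym)

lemma gdist_mono: "S \<subseteq> T \<Longrightarrow> gdist T x y \<le> gdist S x y"
  unfolding gdist_def walk_from_to_def by (intro INF_superset_mono) auto

lemma gdist_pos: "x \<noteq> y \<Longrightarrow> 1 \<le> gdist S x y"
proof (rule ccontr)
  assume "x \<noteq> y" "\<not> 1 \<le> gdist S x y"
  then have "gdist S x y = enat 0" by (cases "gdist S x y") (auto simp: one_enat_def)
  then obtain xs where "walk_from_to S x y xs" "length xs = Suc 0" by (rule gdist_eq_enatE)
  then show False using \<open>x \<noteq> y\<close> by (auto simp: walk_from_to_def length_Suc_conv)
qed

lemma gdist_map_le: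
  assumes "\<And>a b. {a, b} \<in> S \<Longrightarrow> gdist T (f a) (f b) \<le> enat L" "gdist S x y = enat k"
  shows "gdist T (f x) (f y) \<le> enat (k * L)"
proof -
  obtain xs where xs: "walk_from_to S x y xs" "length xs = Suc k" using gdist_eq_enatE[OF assms(2)] .
  from xs show ?thesis
  proof (induction k arbitrary: x xs)
    case 0
    then show ?case by (auto simp: walk_from_to_def length_Suc_conv zero_enat_def[symmetric])
  next
    case (Suc k)
    obtain z zs where "xs = x # z # zs" "length zs = k"
      using Suc.prems by (auto simp: walk_from_to_def length_Suc_conv)
    then have *: "{x, z} \<in> S" "walk_from_to S z y (z # zs)" "length (z # zs) = Suc k"
      using Suc.prems(1) by (auto simp: walk_from_to_iff_successively)
    have "gdist T (f x) (f y) \<le> gdist T (f x) (f z) + gdist T (f z) (f y)" by (rule gdist_triangle)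
    also have "\<dots> \<le> enat L + enat (k * L)"
      by (intro add_mono assms(1) Suc.IH[OF *(2,3)] *(1))
    finally show ?case by simp
  qed
qed

subsection \<open>The hypercube\<close>

text \<open>This is the addition of the unit vector of coordinate \<open>i\<close> modulo 2.\<close>

definition flip :: "nat \<Rightarrow> nat set \<Rightarrow> nat set" where
  "flip i x = {j. (j \<in> x) \<noteq> (j = i)}"

lemma flip_flip [simp]: "flip i (flip i x) = x"
  by (auto simp: flip_def)

lemma flip_commute: "flip i (flip j x) = flip j (flip i x)"
  by (auto simp: flip_def)

lemma flip_neq [simp]: "flip i x \<noteq> x" "x \<noteq> flip i x"
  by (auto simp: flip_def)

lemma flip_in_vertices: "x \<in> hc_vertices n \<Longrightarrow> i < n \<Longrightarrow> flip i x \<in> hc_vertices n"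
  by (auto simp: flip_def hc_vertices_def)

lemma finite_vertices: "finite (hc_vertices n)"
  by (simp add: hc_vertices_def)

lemma card_vertices: "card (hc_vertices n) = 2 ^ n"
  by (simp add: hc_vertices_def card_Pow)

lemma edge_flip:
  assumes "x \<in> hc_vertices n" "i < n"
  shows "{x, flip i x} \<in> hc_edges n"
proof -
  have "sym_diff x (flip i x) = {i}" by (auto simp: flip_def)
  then have "card (sym_diff x (flip i x)) = 1" by simp
  then show ?thesis using assms(1) flip_in_vertices[OF assms] unfolding hc_edges_def by blast
qed

lemma edgeE:
  assumes "e \<in> hc_edges n"
  obtains x i where "x \<in> hc_vertices n" "i < n" "e = {x, flip i x}"
proof -
  obtain x y where xy: "e = {x, y}" "x \<in> hc_vertices n" "y \<in> hc_vertices n" "card (sym_diff x y) = 1"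
    using assms unfolding hc_edges_def by auto
  then obtain i where i: "sym_diff x y = {i}" by (auto simp: card_1_singleton_iff)
  have "y = flip i x" using i unfolding flip_def by blast
  moreover have "i < n" using i xy by (auto simp: hc_vertices_def)
  ultimately show thesis using that xy by blast
qed

lemma edge_pairE:
  assumes "{x, y} \<in> hc_edges n"
  obtains i where "x \<in> hc_vertices n" "i < n" "y = flip i x"
proof -
  obtain z i where z: "z \<in> hc_vertices n" "i < n" "{x, y} = {z, flip i z}" using edgeE[OF assms] .
  then consider "x = z" "y = flip i z" | "y = z" "x = flip i z" by (auto simp: doubleton_eq_iff)
  then show thesis using z flip_in_vertices[OF z(1,2)] by cases (auto intro: that)
qed

lemma finite_edges: "finite (hc_edges n)"
proof (rule finite_subset)
  show "hc_edges n \<subseteq> Pow (hc_vertices n)" by (auto simp: hc_edges_def)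
qed (simp add: finite_vertices)

lemma gdist_flip: "x \<in> hc_vertices n \<Longrightarrow> i < n \<Longrightarrow> gdist (hc_edges n) x (flip i x) \<le> 1"
  by (intro gdist_edge edge_flip)

text \<open>Adding elements one at a time joins \<open>{}\<close> to every vertex, and two vertices
  are then joined through \<open>{}\<close>.\<close>

lemma hypercube_connected:
  assumes "x \<in> hc_vertices n" "y \<in> hc_vertices n"
  shows "gdist (hc_edges n) x y \<noteq> \<infinity>"
proof -
  have *: "gdist (hc_edges n) {} x \<noteq> \<infinity>" if "x \<in> hc_vertices n" for x
  proof -
    have "finite x" using that by (auto simp: hc_vertices_def finite_subset)
    then show ?thesis using that
    proof (induction x rule: finite_induct)
      case (insert i x)
      then have x: "x \<in> hc_vertices n" "i < n" by (auto simp: hc_vertices_def)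
      have "flip i x = insert i x" using insert by (auto simp: flip_def)
      with gdist_flip[OF x] have "gdist (hc_edges n) x (insert i x) \<le> 1" by simp
      then have "gdist (hc_edges n) {} (insert i x) \<le> gdist (hc_edges n) {} x + 1"
        using gdist_triangle by (meson add_left_mono order_trans)
      moreover have "gdist (hc_edges n) {} x + 1 \<noteq> \<infinity>"
        using insert.IH x by (simp add: plus_eq_infty_iff_enat)
      ultimately show ?case by (metis enat_ord_simps(5))
    qed simp
  qed
  have "gdist (hc_edges n) x y \<le> gdist (hc_edges n) {} x + gdist (hc_edges n) {} y"
    using gdist_triangle[of _ x y "{}"] gdist_sym[of _ x "{}"] by simp
  moreover have "gdist (hc_edges n) {} x + gdist (hc_edges n) {} y \<noteq> \<infinity>"
    using *[OF assms(1)] *[OF assms(2)] by (simp add: plus_eq_infty_iff_enat)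
  ultimately show ?thesis by (metis enat_ord_simps(5))
qed

text \<open>The bound on edges extends along shortest walks, so D_+ is at most \<open>L\<close>.
  Since \<open>f\<close> moves points by at most 1 and open distances are at least cube distances,
  D_- is at least 1/3.\<close>

lemma hc_distortion_le:
  assumes "S \<subseteq> hc_edges n" "0 < n" "0 < L"
    and f: "\<And>x. x \<in> hc_vertices n \<Longrightarrow> f x \<in> hc_vertices n"
    and near: "\<And>x. x \<in> hc_vertices n \<Longrightarrow> gdist (hc_edges n) x (f x) \<le> 1"
    and lip: "\<And>x i. x \<in> hc_vertices n \<Longrightarrow> i < n \<Longrightarrow> gdist S (f x) (f (flip i x)) \<le> enat L"
  shows "hc_distortion n S \<le> ereal (3 * real L)"
proof -
  let ?V = "hc_vertices n" and ?d = "gdist (hc_edges n)"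
  let ?P = "{(a, b). a \<in> ?V \<and> b \<in> ?V \<and> a \<noteq> b}"
  have fin: "\<exists>k. ?d a b = enat k \<and> 1 \<le> k" if "a \<in> ?V" "b \<in> ?V" "a \<noteq> b" for a b
    using hypercube_connected[OF that(1,2)] gdist_pos[OF that(3), of "hc_edges n"]
    by (cases "?d a b") (auto simp: one_enat_def)
  have lip': "gdist S (f a) (f b) \<le> enat L" if "{a, b} \<in> hc_edges n" for a b
    using that by (rule edge_pairE) (auto intro: lip)
  have plus: "dist_plus ?V ?d (gdist S) f \<le> ereal L"
    unfolding dist_plus_def
  proof (intro max.boundedI SUP_least, goal_cases)
    case 1
    then show ?case using assms(3) by simp
  next
    case (2 ab)
    then obtain a b where ab: "ab = (a, b)" "a \<in> ?V" "b \<in> ?V" "a \<noteq> b" by auto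
    obtain k where k: "?d a b = enat k" "1 \<le> k" using fin[OF ab(2-4)] by auto
    have "gdist S (f a) (f b) \<le> enat (k * L)" using lip' k(1) by (rule gdist_map_le)
    then obtain l where l: "gdist S (f a) (f b) = enat l" "l \<le> k * L"
      by (cases "gdist S (f a) (f b)") auto
    have "real l \<le> real k * real L" using l(2) by (simp flip: of_nat_mult)
    then show ?case using k l by (simp add: ab(1) divide_simps mult.commute)
  qed
  have minus: "ereal (1/3) \<le> dist_minus ?V ?d (gdist S) f"
    unfolding dist_minus_def
  proof (intro INF_greatest, goal_cases)
    case (1 ab)
    then obtain a b where ab: "ab = (a, b)" "a \<in> ?V" "b \<in> ?V" "a \<noteq> b" by auto
    obtain k where k: "?d a b = enat k" "1 \<le> k" using fin[OF ab(2-4)] by auto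
    have kl: "enat k \<le> gdist S (f a) (f b) + 2"
    proof -
      have "?d a b \<le> ?d a (f a) + (?d (f a) (f b) + ?d (f b) b)"
        by (meson gdist_triangle add_left_mono order_trans)
      also have "\<dots> \<le> 1 + (gdist S (f a) (f b) + 1)"
        using ab by (intro add_mono near gdist_mono assms(1)) (auto simp: gdist_sym intro: near)
      finally show ?thesis using k by (simp add: algebra_simps flip: one_add_one)
    qed
    show ?case
    proof (cases "gdist S (f a) (f b)")
      case (enat l)
      have "k \<le> l + 2" using kl enat by (simp add: numeral_eq_enat)
      \<comment> \<open>The maximum in D_- covers \<open>l = 0\<close>, where \<open>k\<close> can
        be 2; the extremal case is \<open>l = 1\<close>, \<open>k = 3\<close>.\<close>
      then have "real k \<le> 3 * max 1 (real l)" by (simp add: max_def)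
      then have "ereal (1/3) \<le> ereal (max 1 (real l) / real k)"
        using k(2) by (simp add: field_simps)
      also have "\<dots> = max 1 (ereal (real l)) / ereal (real k)"
        using k(2) by (auto simp: max_def one_ereal_def)
      finally show ?thesis using k enat by (simp add: ab(1))
    next
      case infinity
      then show ?thesis using k by (simp add: ab(1) max_def)
    qed
  qed
  have "map_distortion ?V ?d (gdist S) f \<le> ereal (3 * L)"
  proof -
    have ge1: "1 \<le> dist_plus ?V ?d (gdist S) f" by (simp add: dist_plus_def)
    then obtain u where u: "dist_plus ?V ?d (gdist S) f = ereal u" "1 \<le> u" "u \<le> L"
      using plus by (cases "dist_plus ?V ?d (gdist S) f") auto
    show ?thesis
    \<comment> \<open>Minus infinity is excluded by \<open>minus\<close>, and infinity makes the
      quotient 0, so only the real case needs arithmetic.\<close>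
    proof (cases "dist_minus ?V ?d (gdist S) f")
      case (real v)
      then have v: "1/3 \<le> v" using minus by simp
      have "u \<le> 3 * L * v" using mult_mono[of "1" "3 * v" u L] u v by (simp add: field_simps)
      then show ?thesis using v by (simp add: map_distortion_def u(1) real divide_simps)
    qed (use minus u in \<open>auto simp: map_distortion_def\<close>)
  qed
  then show ?thesis unfolding hc_distortion_def
    using f by (intro INF_lower2[of f]) auto
qed

subsection \<open>Good edges\<close>

text \<open>Passing from \<open>u\<close> to \<open>u - X\<close> forgets the coordinates in
  \<open>X\<close>: equality of \<open>u - X\<close> and \<open>v - X\<close> means that
  \<open>u\<close> and \<open>v\<close> lie in the same subcube with directions
  \<open>X\<close>.\<close>

lemma flip_Diff_eq [simp]: "flip j u - X = u - X \<longleftrightarrow> j \<in> X"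
  by (auto simp: flip_def)

lemma flip_Diff_eq_flip: "flip j u - X = flip k u - X \<longleftrightarrow> j = k \<or> j \<in> X \<and> k \<in> X"
  unfolding flip_def set_eq_iff by auto

lemma flip_flip_Diff: "k \<in> X \<Longrightarrow> flip j (flip k u) - X = flip j u - X"
  by (subst flip_commute) simp

lemma flip_eq_flip_iff [simp]: "flip j u = flip k u \<longleftrightarrow> j = k"
  using flip_Diff_eq_flip[of j u "{}" k] by simp

lemma flip_flip_neq: "j \<noteq> k \<Longrightarrow> flip j (flip k u) \<noteq> u"
  by (metis flip_flip flip_eq_flip_iff)

text \<open>Edges are located by the subcube through \<open>u\<close> with directions
  \<open>X\<close>. The empty set is excluded since it would belong to every region and spoil
  disjointness.\<close>

definition region :: "nat set \<Rightarrow> nat set \<Rightarrow> nat set set set" where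
  "region X u = {e. e \<noteq> {} \<and> (\<forall>w\<in>e. w - X = u - X)}"

lemma region_mono: "X \<subseteq> Y \<Longrightarrow> u - Y = v - Y \<Longrightarrow> region X u \<subseteq> region Y v"
  unfolding region_def by blast

lemma region_disjoint:
  assumes "u - X \<noteq> v - X"
  shows "region X u \<inter> region X v = {}"
proof (rule ccontr)
  assume "region X u \<inter> region X v \<noteq> {}"
  then obtain e w where "w \<in> e" "\<forall>w\<in>e. w - X = u - X" "\<forall>w\<in>e. w - X = v - X"
    unfolding region_def by blast
  then show False using assms by metis
qed

lemma edge_in_region:
  assumes "i \<in> X" "u - X = v - X"
  shows "{u, flip i u} \<in> region X v"
proof -
  have "flip i u - X = v - X" using assms flip_Diff_eq[of i u X] by metis
  then show ?thesis using assms(2) unfolding region_def by blast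
qed

lemma not_in_region: "w \<in> e \<Longrightarrow> w - X \<noteq> u - X \<Longrightarrow> e \<notin> region X u"
  unfolding region_def by blast

text \<open>The edge in question is \<open>{u, flip i u}\<close>. Level \<open>Suc t\<close> takes
  its detour direction from \<open>C t\<close>, so the levels below use only classes of smaller
  index. Removing \<open>i\<close> keeps the detour from running along the edge itself.\<close>

primrec good :: "(nat \<Rightarrow> nat set) \<Rightarrow> nat \<Rightarrow> nat \<Rightarrow> nat set \<Rightarrow> nat set set set \<Rightarrow> bool" where
  "good C i 0 u S \<longleftrightarrow> {u, flip i u} \<in> S"
| "good C i (Suc t) u S \<longleftrightarrow> (\<exists>j\<in>C t - {i}.
     {u, flip j u} \<in> S \<and> {flip i u, flip j (flip i u)} \<in> S \<and> good C i t (flip j u) S)"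

lemma gdist_good: "good C i t u S \<Longrightarrow> gdist S u (flip i u) \<le> enat (2 * t + 1)"
proof (induction t arbitrary: u)
  case 0
  then show ?case using gdist_edge[of u "flip i u" S] by (simp add: one_enat_def)
next
  case (Suc t)
  then obtain j where j: "{u, flip j u} \<in> S" "{flip i u, flip j (flip i u)} \<in> S"
    "good C i t (flip j u) S" by auto
  have "gdist S (flip j u) (flip j (flip i u)) \<le> enat (2 * t + 1)"
    using Suc.IH[OF j(3)] by (simp add: flip_commute[of i j])
  moreover have "gdist S (flip j (flip i u)) (flip i u) \<le> 1"
    using gdist_edge[OF j(2)] by (simp add: gdist_sym)
  ultimately have "gdist S u (flip i u) \<le> 1 + (enat (2 * t + 1) + 1)"
    by (intro gdist_triangle_le[OF gdist_edge[OF j(1)]] gdist_triangle_le)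
  then show ?case by (simp add: one_enat_def)
qed

text \<open>All detours stay in the subcube through \<open>u\<close> spanned by \<open>i\<close> and
  the classes used so far.\<close>

lemma supported_good: "supported (region (insert i (\<Union>s<t. C s)) u) {S. good C i t u S}"
proof (induction t arbitrary: u)
  case 0
  then show ?case using supported_mem[OF edge_in_region] by simp
next
  case (Suc t)
  let ?Y = "insert i (\<Union>s<Suc t. C s)"
  have "{S. good C i (Suc t) u S} = (\<Union>j\<in>C t - {i}. {S. {u, flip j u} \<in> S} \<inter>
      ({S. {flip i u, flip j (flip i u)} \<in> S} \<inter> {S. good C i t (flip j u) S}))" by auto
  moreover have "supported (region ?Y u) \<dots>"
  proof (intro supported_UN supported_Int)
    fix j assume j: "j \<in> C t - {i}"
    then have jY: "j \<in> ?Y" by auto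
    show "supported (region ?Y u) {S. {u, flip j u} \<in> S}"
      by (intro supported_mem edge_in_region jY refl)
    have "flip i u - ?Y = u - ?Y" by (subst flip_Diff_eq) simp
    with jY show "supported (region ?Y u) {S. {flip i u, flip j (flip i u)} \<in> S}"
      by (intro supported_mem edge_in_region)
    have "flip j u - ?Y = u - ?Y" using jY by (subst flip_Diff_eq)
    then show "supported (region ?Y u) {S. good C i t (flip j u) S}"
      by (intro supported_mono[OF Suc.IH region_mono]) (auto simp only: lessThan_Suc UN_insert)
  qed
  ultimately show ?case by (simp only:)
qed

section \<open>Recursive bounds for the probability that an edge is good\<close>

locale direction_classes =
  fixes n :: nat and p :: real and C :: "nat \<Rightarrow> nat set"
  assumes p01: "0 \<le> p" "p \<le> 1"
    and C_less: "C t \<subseteq> {..<n}"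
    and C_disjoint: "s \<noteq> t \<Longrightarrow> C s \<inter> C t = {}"
begin

abbreviation P :: "nat set set set set \<Rightarrow> real" where
  "P \<equiv> bern (hc_edges n) p"

lemmas P_Compl = bern_Compl[OF finite_edges p01, of n]
lemmas P_mono = bern_mono[OF finite_edges p01, of n]
lemmas P_le_1 = bern_le_1[OF finite_edges p01, of n]
lemmas P_indep = bern_indep[OF finite_edges p01, of _ _ _ _ n]
lemmas P_mem = bern_mem[OF finite_edges p01]
lemmas P_none_le = bern_none_le[OF finite_edges p01, of _ _ _ n]
lemmas P_Un_le = bern_Un_le[OF finite_edges p01, of n]
lemmas P_UN_le = bern_UN_le[OF finite_edges p01, of _ n]

lemma finite_C: "finite (C t)"
  using finite_subset[OF C_less] by simp

lemma C_notin_UN: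
  assumes "j \<in> C t"
  shows "j \<notin> (\<Union>s<t. C s)"
proof
  assume "j \<in> (\<Union>s<t. C s)"
  then obtain s where "s < t" "j \<in> C s \<inter> C t" using assms by blast
  then show False using C_disjoint[of s t] by simp
qed

text \<open>Different detour directions are independent: the edges opposite to
  \<open>{u, flip i u}\<close> lie in disjoint subcubes, and the side edges are distinct and lie in
  none of these. Each direction succeeds with probability at least
  \<open>p\<^sup>2 * q\<close>.\<close>

lemma P_not_good_Suc:
  assumes q: "\<And>v. v \<in> hc_vertices n \<Longrightarrow> q \<le> P {S. good C i t v S}" and "0 \<le> q"
    and u: "u \<in> hc_vertices n" and i: "i < n"
  shows "P {S. \<not> good C i (Suc t) u S} \<le> (1 - p\<^sup>2 * q) ^ card (C t - {i})"
proof -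
  let ?X = "insert i (\<Union>s<t. C s)"
  define A where "A = (\<lambda>j. {S. {u, flip j u} \<in> S} \<inter>
      ({S. {flip i u, flip j (flip i u)} \<in> S} \<inter> {S. good C i t (flip j u) S}))"
  define F where "F = (\<lambda>j. {{u, flip j u}} \<union> ({{flip i u, flip j (flip i u)}} \<union> region ?X (flip j u)))"
  have X: "j \<notin> ?X" if "j \<in> C t - {i}" for j
    using that C_notin_UN by auto
  \<comment> \<open>Each side edge has an end in the subcube through \<open>u\<close>, and flipping
    \<open>k\<close> leaves that subcube.\<close>
  have nr: "{u, flip j u} \<notin> region ?X (flip k u)"
    "{flip i u, flip j (flip i u)} \<notin> region ?X (flip k u)" if "k \<in> C t - {i}" for j k
  proof -
    have *: "u - ?X \<noteq> flip k u - ?X"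
      using X[OF that] flip_Diff_eq[of k u ?X] by metis
    then show "{u, flip j u} \<notin> region ?X (flip k u)"
      by (intro not_in_region[of u]) simp_all
    have "flip i u - ?X = u - ?X" by (subst flip_Diff_eq) simp
    with * have "flip i u - ?X \<noteq> flip k u - ?X" by metis
    then show "{flip i u, flip j (flip i u)} \<notin> region ?X (flip k u)"
      by (intro not_in_region[of "flip i u"]) simp_all
  qed
  have ne: "{u, flip j u} \<noteq> {flip i u, flip k (flip i u)}" if "k \<noteq> i" for j k
    using that flip_flip_neq[of k i u] by (metis doubleton_eq_iff flip_neq(2))
  have sup: "supported (F j) (A j)" for j
    unfolding A_def F_def
    by (intro supported_Int supported_mono[OF supported_good] supported_mem) auto
  have disj: "disjoint_family_on F (C t - {i})"
    unfolding disjoint_family_on_def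
  proof (intro ballI impI)
    fix j k assume jk: "j \<in> C t - {i}" "k \<in> C t - {i}" "j \<noteq> k"
    have "region ?X (flip j u) \<inter> region ?X (flip k u) = {}"
      by (rule region_disjoint) (use jk X[OF jk(1)] in \<open>auto simp: flip_Diff_eq_flip\<close>)
    moreover have "{u, flip j u} \<noteq> {u, flip k u}"
      "{flip i u, flip j (flip i u)} \<noteq> {flip i u, flip k (flip i u)}"
      using jk(3) by (auto simp: doubleton_eq_iff)
    ultimately show "F j \<inter> F k = {}"
      unfolding F_def using nr[OF jk(1)] nr[OF jk(2)] ne[of j k] ne[of k j] jk
      by (simp add: Int_Un_distrib Int_Un_distrib2)
  qed
  have r: "P (- A j) \<le> 1 - p\<^sup>2 * q" if j: "j \<in> C t - {i}" for j
  proof -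
    have jn: "j < n" using j C_less by auto
    have "P (A j) = P {S. {u, flip j u} \<in> S} *
        P ({S. {flip i u, flip j (flip i u)} \<in> S} \<inter> {S. good C i t (flip j u) S})"
      unfolding A_def
      by (rule P_indep[of "{{u, flip j u}}" _ "{{flip i u, flip j (flip i u)}} \<union> region ?X (flip j u)"])
        (use nr[OF j] ne[of j j] j in \<open>auto intro!: supported_Int supported_mono[OF supported_good] supported_mem\<close>)
    also have "P ({S. {flip i u, flip j (flip i u)} \<in> S} \<inter> {S. good C i t (flip j u) S})
        = P {S. {flip i u, flip j (flip i u)} \<in> S} * P {S. good C i t (flip j u) S}"
      by (rule P_indep[of "{{flip i u, flip j (flip i u)}}" _ "region ?X (flip j u)"])
        (use nr[OF j] in \<open>auto intro!: supported_good supported_mem\<close>)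
    finally have "P (A j) = p\<^sup>2 * P {S. good C i t (flip j u) S}"
      using u i jn by (simp add: P_mem edge_flip flip_in_vertices power2_eq_square)
    moreover have "p\<^sup>2 * q \<le> p\<^sup>2 * P {S. good C i t (flip j u) S}"
      using q[OF flip_in_vertices[OF u jn]] by (intro mult_left_mono) auto
    ultimately show ?thesis by (simp add: P_Compl)
  qed
  have "0 \<le> 1 - p\<^sup>2 * q"
  proof -
    have "q \<le> 1" using q[OF u] P_le_1 by (rule order_trans)
    then show ?thesis using p01 \<open>0 \<le> q\<close> by (simp add: mult_le_one power_le_one)
  qed
  then have "P (\<Inter>j\<in>C t - {i}. - A j) \<le> (1 - p\<^sup>2 * q) ^ card (C t - {i})"
    by (intro P_none_le[OF _ sup disj r]) (simp_all add: finite_C)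
  moreover have "(\<Inter>j\<in>C t - {i}. - A j) = {S. \<not> good C i (Suc t) u S}"
    by (auto simp: A_def)
  ultimately show ?thesis by simp
qed

end

text \<open>This follows from \<open>exp (- y) \<le> inverse (1 + y)\<close>. It turns the
  exponential bound on failure into linear growth of the success probability, capped at 1/2.\<close>

lemma one_minus_exp_ge:
  fixes y :: real
  assumes "0 \<le> y"
  shows "min (1/2) (y / 2) \<le> 1 - exp (- y)"
proof -
  have "exp (- y) \<le> inverse (1 + y)"
    using assms exp_ge_add_one_self[of y] by (simp add: exp_minus le_imp_inverse_le)
  moreover have "min (1/2) (y / 2) \<le> 1 - inverse (1 + y)"
  proof (cases "y \<le> 1")
    case True
    have "y * y \<le> y * 1" using True assms by (intro mult_left_mono)
    then show ?thesis using True assms by (simp add: min_def field_simps)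
  next
    case False
    then show ?thesis by (simp add: min_def field_simps)
  qed
  ultimately show ?thesis by linarith
qed

lemma power_one_minus_le_exp:
  fixes s :: real and m k :: nat
  assumes "0 \<le> s" "s \<le> 1" "m \<le> k"
  shows "(1 - s) ^ k \<le> exp (- (m * s))"
proof -
  have "(1 - s) ^ k \<le> (1 - s) ^ m" using assms by (intro power_decreasing) auto
  also have "\<dots> \<le> exp (- s) ^ m"
    using assms exp_ge_add_one_self[of "- s"] by (intro power_mono) auto
  also have "\<dots> = exp (- (m * s))" by (simp add: exp_of_nat_mult[symmetric])
  finally show ?thesis .
qed

context direction_classes
begin

context
  fixes m :: nat and g :: real and N :: nat
  assumes m: "\<And>t i. t \<le> N \<Longrightarrow> m \<le> card (C t - {i})"
    and g: "1 \<le> g" "g \<le> m * p\<^sup>2 / 2"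
begin

lemma P_not_good_Suc_le_exp:
  assumes q: "\<And>v. v \<in> hc_vertices n \<Longrightarrow> q \<le> P {S. good C i t v S}" and "0 \<le> q"
    and u: "u \<in> hc_vertices n" and i: "i < n" and "t \<le> N"
  shows "P {S. \<not> good C i (Suc t) u S} \<le> exp (- (2 * g * q))"
proof -
  have "q \<le> 1" using q[OF u] P_le_1 by (rule order_trans)
  have "P {S. \<not> good C i (Suc t) u S} \<le> (1 - p\<^sup>2 * q) ^ card (C t - {i})"
    using assms by (intro P_not_good_Suc)
  also have "\<dots> \<le> exp (- (m * (p\<^sup>2 * q)))"
    using p01 \<open>0 \<le> q\<close> \<open>q \<le> 1\<close> m[OF \<open>t \<le> N\<close>]
    by (intro power_one_minus_le_exp) (auto simp: mult_le_one power_le_one)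
  also have "\<dots> \<le> exp (- (2 * g * q))"
    using mult_right_mono[OF g(2) \<open>0 \<le> q\<close>] by simp
  finally show ?thesis .
qed

text \<open>Each level multiplies the lower bound by \<open>g\<close> until it reaches 1/2, where it
  stays because \<open>1 \<le> g\<close>. The half in \<open>g \<le> m * p\<^sup>2 / 2\<close> pays
  for the half lost in \<open>one_minus_exp_ge\<close>.\<close>

lemma P_good_ge:
  assumes "u \<in> hc_vertices n" "i < n" "t \<le> N"
  shows "min (1/2) (p * g ^ t) \<le> P {S. good C i t u S}"
  using assms
proof (induction t arbitrary: u)
  case 0
  then show ?case by (simp add: P_mem edge_flip)
next
  case (Suc t)
  let ?q = "min (1/2) (p * g ^ t)"
  have q0: "0 \<le> ?q" using p01 g by simp
  have "P {S. \<not> good C i (Suc t) u S} \<le> exp (- (2 * g * ?q))"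
    using Suc q0 by (intro P_not_good_Suc_le_exp) auto
  moreover have "{S. good C i (Suc t) u S} = - {S. \<not> good C i (Suc t) u S}" by auto
  ultimately have "1 - exp (- (2 * g * ?q)) \<le> P {S. good C i (Suc t) u S}"
    by (simp only: P_Compl)
  moreover have "min (1/2) (g * ?q) \<le> 1 - exp (- (2 * g * ?q))"
    using one_minus_exp_ge[of "2 * g * ?q"] q0 g by simp
  moreover have "min (1/2) (p * g ^ Suc t) \<le> min (1/2) (g * ?q)"
  proof (cases "p * g ^ t \<le> 1/2")
    case True
    then show ?thesis by (simp add: min_absorb2 algebra_simps)
  next
    case False
    then have "g * ?q = g / 2" by simp
    then show ?thesis using g(1) by simp
  qed
  ultimately show ?case by (meson order_trans)
qed

text \<open>Once the success probability is at least 1/2, one more level gives failure at most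
  \<open>exp (- (2 * g * (1/2)))\<close>.\<close>

lemma P_not_good_le:
  assumes "1/2 \<le> p * g ^ t" "u \<in> hc_vertices n" "i < n" "t \<le> N"
  shows "P {S. \<not> good C i (Suc t) u S} \<le> exp (- g)"
proof -
  have "1/2 \<le> P {S. good C i t v S}" if "v \<in> hc_vertices n" for v
    using P_good_ge[OF that assms(3,4)] assms(1) by simp
  from P_not_good_Suc_le_exp[OF this _ assms(2-4)] show ?thesis by simp
qed

end

section \<open>Amplification to failure probabilities that beat the number of vertices\<close>

context
  fixes N :: nat and \<delta> :: real
  assumes \<delta>: "\<And>u i. u \<in> hc_vertices n \<Longrightarrow> i < n \<Longrightarrow> P {S. \<not> good C i N u S} \<le> \<delta>"
    and \<delta>0: "0 \<le> \<delta>"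
begin

text \<open>Different \<open>k\<close> lead to disjoint subcubes with directions \<open>C 0\<close>,
  ..., \<open>C N\<close>, so the candidates are independent; \<open>C N\<close> is included because
  it supplies the directions of the tested edges. Within one candidate a union bound over at most
  \<open>n\<close> edges suffices.\<close>

lemma P_no_anchor_le:
  assumes x: "x \<in> hc_vertices n"
  shows "P {S. \<forall>k\<in>C (Suc N). \<exists>j\<in>C N. \<not> good C j N (flip k x) S} \<le> (n * \<delta>) ^ card (C (Suc N))"
proof -
  define A where "A = (\<lambda>k. \<Inter>j\<in>C N. {S. good C j N (flip k x) S})"
  let ?X = "\<Union>s<Suc N. C s"
  have "P (\<Inter>k\<in>C (Suc N). - A k) \<le> (n * \<delta>) ^ card (C (Suc N))"
  proof (rule P_none_le[where F = "\<lambda>k. region ?X (flip k x)"])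
    fix k assume k: "k \<in> C (Suc N)"
    show "supported (region ?X (flip k x)) (A k)"
      unfolding A_def
      by (intro supported_INT supported_mono[OF supported_good region_mono]) (auto simp: less_Suc_eq)
    have "- A k = (\<Union>j\<in>C N. {S. \<not> good C j N (flip k x) S})" by (auto simp: A_def)
    also have "P \<dots> \<le> card (C N) * \<delta>"
      using x k C_less by (intro P_UN_le finite_C \<delta> flip_in_vertices) auto
    also have "\<dots> \<le> n * \<delta>"
      using card_mono[OF _ C_less[of N]] \<delta>0 by (intro mult_right_mono) auto
    finally show "P (- A k) \<le> n * \<delta>" .
  next
    show "disjoint_family_on (\<lambda>k. region ?X (flip k x)) (C (Suc N))"
      unfolding disjoint_family_on_def
      using C_notin_UN by (intro ballI impI region_disjoint) (auto simp: flip_Diff_eq_flip)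
  qed (use \<delta>0 finite_C in auto)
  moreover have "(\<Inter>k\<in>C (Suc N). - A k) = {S. \<forall>k\<in>C (Suc N). \<exists>j\<in>C N. \<not> good C j N (flip k x) S}"
    by (auto simp: A_def)
  ultimately show ?thesis by simp
qed

text \<open>The path from \<open>u\<close> in directions \<open>k\<close>, \<open>i\<close>,
  \<open>l\<close> is translated by \<open>j\<close>. Translates lie in disjoint subcubes because
  these directions are removed from \<open>C N\<close>. The three edges of one translate may be
  dependent, hence the union bound \<open>3 * \<delta>\<close>.\<close>

lemma P_no_bridge_le:
  assumes u: "u \<in> hc_vertices n" and kil: "k < n" "i < n" "l < n"
  shows "P {S. \<forall>j\<in>C N - {k, i, l}. \<not> (good C k N (flip j u) S \<and>
      good C i N (flip j (flip k u)) S \<and> good C l N (flip j (flip i (flip k u))) S)}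
    \<le> (3 * \<delta>) ^ card (C N - {k, i, l})"
proof -
  define A where "A = (\<lambda>j. {S. good C k N (flip j u) S} \<inter>
      ({S. good C i N (flip j (flip k u)) S} \<inter> {S. good C l N (flip j (flip i (flip k u))) S}))"
  let ?X = "(\<Union>s<N. C s) \<union> {k, i, l}"
  have "P (\<Inter>j\<in>C N - {k, i, l}. - A j) \<le> (3 * \<delta>) ^ card (C N - {k, i, l})"
  proof (rule P_none_le[where F = "\<lambda>j. region ?X (flip j u)"])
    fix j assume j: "j \<in> C N - {k, i, l}"
    \<comment> \<open>All three edges lie in the subcube through \<open>flip j u\<close>, since
      \<open>k\<close>, \<open>i\<close> and \<open>l\<close> belong to \<open>?X\<close>.\<close>
    have sup: "supported (region ?X (flip j u)) {S. good C a N v S}"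
      if "a \<in> ?X" "v - ?X = flip j u - ?X" for a v
    proof (rule supported_mono[OF supported_good region_mono])
      show "insert a (\<Union>s<N. C s) \<subseteq> ?X" using that(1) by auto
    qed (fact that(2))
    show "supported (region ?X (flip j u)) (A j)"
      unfolding A_def by (intro supported_Int sup) (simp_all add: flip_flip_Diff)
    have V: "flip k u \<in> hc_vertices n" "flip i (flip k u) \<in> hc_vertices n" "j < n"
      using u kil j C_less by (auto intro!: flip_in_vertices)
    have "- A j = {S. \<not> good C k N (flip j u) S} \<union> ({S. \<not> good C i N (flip j (flip k u)) S} \<union>
        {S. \<not> good C l N (flip j (flip i (flip k u))) S})" by (auto simp: A_def)
    also have "P \<dots> \<le> \<delta> + (\<delta> + \<delta>)"
      using u kil V
      by (intro order_trans[OF P_Un_le] add_mono \<delta> flip_in_vertices) auto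
    finally show "P (- A j) \<le> 3 * \<delta>" by simp
  next
    show "disjoint_family_on (\<lambda>j. region ?X (flip j u)) (C N - {k, i, l})"
      unfolding disjoint_family_on_def
      using C_notin_UN by (intro ballI impI region_disjoint) (auto simp: flip_Diff_eq_flip)
  qed (use \<delta>0 finite_C in auto)
  moreover have "(\<Inter>j\<in>C N - {k, i, l}. - A j) = {S. \<forall>j\<in>C N - {k, i, l}. \<not> (good C k N (flip j u) S \<and>
      good C i N (flip j (flip k u)) S \<and> good C l N (flip j (flip i (flip k u))) S)}"
    by (auto simp: A_def)
  ultimately show ?thesis by simp
qed

end

section \<open>From good edges to a map of bounded distortion\<close>

lemma hc_distortion_le_of_good:
  assumes S: "S \<subseteq> hc_edges n" and n: "0 < n"
    and anchor: "\<And>x. x \<in> hc_vertices n \<Longrightarrow> \<exists>k\<in>C (Suc N). \<forall>j\<in>C N. good C j N (flip k x) S"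
    and bridge: "\<And>u k i l. u \<in> hc_vertices n \<Longrightarrow> k < n \<Longrightarrow> i < n \<Longrightarrow> l < n \<Longrightarrow>
      \<exists>j\<in>C N. good C k N (flip j u) S \<and>
        good C i N (flip j (flip k u)) S \<and> good C l N (flip j (flip i (flip k u))) S"
  shows "hc_distortion n S \<le> ereal (3 * real (5 * (2 * N + 1)))"
proof -
  let ?V = "hc_vertices n" and ?h = "enat (2 * N + 1)"
  obtain \<kappa> where \<kappa>: "\<And>x. x \<in> ?V \<Longrightarrow> \<kappa> x \<in> C (Suc N) \<and> (\<forall>j\<in>C N. good C j N (flip (\<kappa> x) x) S)"
    using anchor by metis
  have \<kappa>n: "\<kappa> x < n" if "x \<in> ?V" for x using \<kappa>[OF that] C_less by blast
  define f where "f = (\<lambda>x. flip (\<kappa> x) x)"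
  have fV: "f x \<in> ?V" if "x \<in> ?V" for x
    using that \<kappa>n by (simp add: f_def flip_in_vertices)
  show ?thesis
  proof (rule hc_distortion_le[OF S n, where f = f])
    fix x assume x: "x \<in> ?V"
    show "gdist (hc_edges n) x (f x) \<le> 1"
      using x \<kappa>n by (simp add: f_def gdist_flip)
  next
    fix x i assume x: "x \<in> ?V" and i: "i < n"
    let ?y = "flip i x"
    have y: "?y \<in> ?V" using x i by (rule flip_in_vertices)
    \<comment> \<open>With this choice the path to be translated runs from \<open>f x\<close>
      through \<open>x\<close> and \<open>flip i x\<close> to \<open>f (flip i x)\<close>.\<close>
    define u k l where "u = f x" and "k = \<kappa> x" and "l = \<kappa> ?y"
    have "flip k u = x" by (simp add: u_def k_def f_def)
    obtain j where j: "j \<in> C N" "good C k N (flip j u) S" "good C i N (flip j x) S" "good C l N (flip j ?y) S"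
      using bridge[of u k i l] x y i \<kappa>n fV \<open>flip k u = x\<close> by (auto simp: u_def k_def l_def)
    \<comment> \<open>The anchors \<open>f x\<close> and \<open>f ?y\<close> have good edges in
      every direction of \<open>C N\<close>, hence also in whichever \<open>j\<close> the bridge
      supplies. These are the first and last of the five good edges.\<close>
    have "gdist S u (flip j u) \<le> ?h"
      using \<kappa>[OF x] j(1) by (intro gdist_good[of C]) (simp add: u_def f_def)
    moreover have "gdist S (flip j u) (flip j x) \<le> ?h"
      using gdist_good[OF j(2)] by (simp add: flip_commute[of k] \<open>flip k u = x\<close>)
    moreover have "gdist S (flip j x) (flip j ?y) \<le> ?h"
      using gdist_good[OF j(3)] by (simp add: flip_commute[of i])
    moreover have "gdist S (flip j ?y) (flip j (f ?y)) \<le> ?h"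
      using gdist_good[OF j(4)] by (simp add: flip_commute[of j "\<kappa> ?y"] f_def l_def)
    moreover have "gdist S (flip j (f ?y)) (f ?y) \<le> ?h"
      using \<kappa>[OF y] j(1) by (subst gdist_sym, intro gdist_good[of C]) (simp add: f_def)
    ultimately have "gdist S u (f ?y) \<le> ?h + (?h + (?h + (?h + ?h)))"
      by (intro gdist_triangle_le)
    then show "gdist S (f x) (f (flip i x)) \<le> enat (5 * (2 * N + 1))"
      by (simp add: u_def eval_nat_numeral)
  qed (use fV in auto)
qed

text \<open>Union bound over \<open>2 ^ n\<close> vertices for the anchors and
  \<open>2 ^ n * n ^ 3\<close> tuples \<open>(u, k, i, l)\<close> for the bridges. Adding 1 to the
  constant makes the inequality strict.\<close>

lemma P_hc_distortion_less_ge: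
  fixes N :: nat and \<delta> B :: real
  assumes \<delta>: "\<And>u i. u \<in> hc_vertices n \<Longrightarrow> i < n \<Longrightarrow> P {S. \<not> good C i N u S} \<le> \<delta>" "0 \<le> \<delta>"
    and anchor: "(n * \<delta>) ^ card (C (Suc N)) \<le> B"
    and bridge: "\<And>k i l. (3 * \<delta>) ^ card (C N - {k, i, l}) \<le> B"
    and n: "0 < n"
  shows "1 - 2 ^ n * (1 + real n ^ 3) * B
    \<le> P {S. hc_distortion n S < ereal (3 * real (5 * (2 * N + 1)) + 1)}"
proof -
  let ?V = "hc_vertices n" and ?I = "{..<n} \<times> {..<n} \<times> {..<n}"
  define U where "U = (\<lambda>x. {S. \<forall>k\<in>C (Suc N). \<exists>j\<in>C N. \<not> good C j N (flip k x) S})"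
  define W where "W = (\<lambda>(u, k, i, l). {S. \<forall>j\<in>C N - {k, i, l}. \<not> (good C k N (flip j u) S \<and>
      good C i N (flip j (flip k u)) S \<and> good C l N (flip j (flip i (flip k u))) S)})"
  have "P (\<Union>x\<in>?V. U x) \<le> card ?V * B"
    unfolding U_def
    by (intro P_UN_le finite_vertices order_trans[OF P_no_anchor_le anchor] \<delta>)
  moreover have "P (\<Union>w\<in>?V \<times> ?I. W w) \<le> card (?V \<times> ?I) * B"
  proof (rule P_UN_le)
    fix w assume "w \<in> ?V \<times> ?I"
    then obtain u k i l where w: "w = (u, k, i, l)" "u \<in> ?V" "k < n" "i < n" "l < n" by auto
    show "P (W w) \<le> B"
      unfolding W_def w(1) prod.case
      by (intro order_trans[OF P_no_bridge_le bridge] \<delta> w(2-5))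
  qed (simp add: finite_vertices)
  ultimately have "P ((\<Union>x\<in>?V. U x) \<union> (\<Union>w\<in>?V \<times> ?I. W w)) \<le> 2 ^ n * B + 2 ^ n * real n ^ 3 * B"
    using P_Un_le[of "\<Union>x\<in>?V. U x" "\<Union>w\<in>?V \<times> ?I. W w"]
    by (simp add: card_vertices card_cartesian_product power3_eq_cube)
  moreover have "P (- ((\<Union>x\<in>?V. U x) \<union> (\<Union>w\<in>?V \<times> ?I. W w)))
      \<le> P {S. hc_distortion n S < ereal (3 * real (5 * (2 * N + 1)) + 1)}"
  proof (rule P_mono)
    fix S assume S: "S \<subseteq> hc_edges n" and
      *: "S \<in> - ((\<Union>x\<in>?V. U x) \<union> (\<Union>w\<in>?V \<times> ?I. W w))"
    have "hc_distortion n S \<le> ereal (3 * real (5 * (2 * N + 1)))"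
    proof (rule hc_distortion_le_of_good[OF S n])
      fix x assume "x \<in> ?V"
      then have "S \<notin> U x" using * by auto
      then show "\<exists>k\<in>C (Suc N). \<forall>j\<in>C N. good C j N (flip k x) S" by (auto simp: U_def)
    next
      fix u k i l assume "u \<in> ?V" "k < n" "i < n" "l < n"
      then have "S \<notin> W (u, k, i, l)" using * by auto
      then show "\<exists>j\<in>C N. good C k N (flip j u) S \<and>
        good C i N (flip j (flip k u)) S \<and> good C l N (flip j (flip i (flip k u))) S"
        by (auto simp: W_def)
    qed
    also have "\<dots> < ereal (3 * real (5 * (2 * N + 1)) + 1)" by simp
    finally show "S \<in> {S. hc_distortion n S < ereal (3 * real (5 * (2 * N + 1)) + 1)}" by simp
  qed
  ultimately show ?thesis by (simp only: P_Compl) (simp add: algebra_simps)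
qed

end

subsection \<open>Choice of the parameters\<close>

text \<open>Each complete block of \<open>R\<close> consecutive integers below \<open>n\<close>
  contributes one element.\<close>

lemma card_residue_class_ge:
  fixes n R c :: nat
  assumes "c < R"
  shows "n div R \<le> card {j. j < n \<and> j mod R = c}"
proof -
  have "card ((\<lambda>q. q * R + c) ` {..<n div R}) = n div R"
    using assms by (subst card_image) (auto simp: inj_on_def)
  moreover have "(\<lambda>q. q * R + c) ` {..<n div R} \<subseteq> {j. j < n \<and> j mod R = c}"
  proof clarify
    fix q assume "q < n div R"
    then have "Suc q * R \<le> n div R * R" by (intro mult_right_mono) auto
    also have "\<dots> \<le> n" by simp
    finally show "q * R + c < n \<and> (q * R + c) mod R = c" using assms by simp
  qed
  ultimately show ?thesis by (metis card_mono finite_Collect_conjI finite_Collect_less_nat)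
qed

lemma real_le_div:
  fixes n R :: nat
  assumes "0 < R"
  shows "real n / real R - 1 \<le> real (n div R)"
proof -
  have "n mod R < R" using assms by simp
  then have "n \<le> R * (n div R) + R" by (metis add_le_cancel_left less_imp_le mult_div_mod_eq)
  then have "real n \<le> real R * real (n div R) + real R"
    by (simp flip: of_nat_mult of_nat_add)
  then show ?thesis using assms by (simp add: field_simps)
qed

text \<open>The exponent \<open>R * k\<close> falls short of \<open>n\<close> by at most
  \<open>4 * R\<close>: \<open>R\<close> for rounding and \<open>3 * R\<close> for three removed
  directions. This loss becomes the constant factor.\<close>

lemma quarter_power_le:
  fixes r :: real and n R k :: nat
  assumes "0 \<le> r" "r \<le> (1/4) ^ R" "n div R - 3 \<le> k" "0 < R"
  shows "r ^ k \<le> 4 ^ (4 * R) * (1/4) ^ n"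
proof -
  have "n mod R < R" using assms by simp
  moreover have "R * (n div R) \<le> R * k + 3 * R"
    using mult_le_mono2[of "n div R" "k + 3" R] assms(3) by (simp add: algebra_simps)
  ultimately have "n \<le> R * k + 4 * R" using mult_div_mod_eq[of R n] by linarith
  then have "(1/4 :: real) ^ (R * k + 4 * R) \<le> (1/4) ^ n" by (intro power_decreasing) auto
  then have "(1/4 :: real) ^ (R * k) \<le> 4 ^ (4 * R) * (1/4) ^ n"
    by (simp add: power_add power_one_over field_simps)
  moreover have "r ^ k \<le> ((1/4) ^ R) ^ k" using assms by (intro power_mono) auto
  ultimately show ?thesis by (simp add: power_mult)
qed

theorem theorem1:
  fixes \<alpha> :: real
  assumes "0 < \<alpha>" and "\<alpha> < 1/2"
  shows "\<exists>c :: real.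
    (\<lambda>n. perc_prob n (real n powr (- \<alpha>)) {S. hc_distortion n S < ereal c})
      \<longlonglongrightarrow> 1"
proof -
  \<comment> \<open>With half the gap, \<open>n * p\<^sup>2\<close> equals
    \<open>n powr (2 * \<epsilon>)\<close> and exceeds \<open>n powr \<epsilon>\<close> by a
    positive power of \<open>n\<close>.\<close>
  define \<epsilon> where "\<epsilon> = (1 - 2 * \<alpha>) / 2"
  have \<epsilon>: "0 < \<epsilon>" "\<epsilon> + 2 * \<alpha> < 1" using assms by (auto simp: \<epsilon>_def field_simps)
  \<comment> \<open>After \<open>T\<close> levels \<open>p * g ^ T\<close>, which is
    \<open>n powr (\<epsilon> * T - \<alpha>)\<close>, is at least 1.\<close>
  obtain T :: nat where T: "\<alpha> \<le> \<epsilon> * T"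
    using reals_Archimedean3[OF \<epsilon>(1)] less_imp_le by (metis mult.commute)
  \<comment> \<open>The level after \<open>T\<close> makes failure exponentially unlikely. The
    classes \<open>C 0\<close>, ..., \<open>C (N + 1)\<close> require \<open>R = N + 2\<close>
    residues, so everything depends on \<alpha> only.\<close>
  define N R where "N = Suc T" and "R = N + 2"
  define c where "c = 3 * real (5 * (2 * N + 1)) + 1"
  define lower where "lower = (\<lambda>n. 1 - 4 ^ (4 * R) * ((1 + real n ^ 3) * (1/2) ^ n))"
  have R: "0 < R" "0 < real R" by (auto simp: R_def)

  \<comment> \<open>Of the subtracted 2, one accounts for rounding in \<open>n div R\<close> and one
    for removing \<open>i\<close> from a class.\<close>
  have "\<forall>\<^sub>F n :: nat in sequentially.
      real n powr \<epsilon> \<le> (real n / real R - 2) * (real n powr (- \<alpha>))\<^sup>2 / 2"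
    using \<epsilon> R assms by real_asymp
  moreover have "\<forall>\<^sub>F n :: nat in sequentially. real n * exp (- (real n powr \<epsilon>)) \<le> (1/4) ^ R"
  proof -
    have "(\<lambda>n :: nat. real n * exp (- (real n powr \<epsilon>))) \<longlonglongrightarrow> 0"
      using \<epsilon>(1) by real_asymp
    then have "\<forall>\<^sub>F n :: nat in sequentially. real n * exp (- (real n powr \<epsilon>)) < (1/4) ^ R"
      by (rule order_tendstoD) simp
    then show ?thesis by eventually_elim simp
  qed
  moreover have "\<forall>\<^sub>F n :: nat in sequentially. 3 \<le> n" by (rule eventually_ge_at_top)
  ultimately have low: "\<forall>\<^sub>F n in sequentially.
      lower n \<le> perc_prob n (real n powr (- \<alpha>)) {S. hc_distortion n S < ereal c}"
  proof eventually_elim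
    case (elim n)
    define p where "p = real n powr (- \<alpha>)"
    define g where "g = real n powr \<epsilon>"
    \<comment> \<open>Residue classes are pairwise disjoint for all indices; those with index at
      least \<open>R\<close> are empty, and only smaller ones need to be large.\<close>
    define C where "C = (\<lambda>t. {j. j < n \<and> j mod R = t})"
    have "p \<le> 1"
      using elim(3) assms by (simp add: p_def powr_minus inverse_le_1_iff ge_one_powr_ge_zero)
    then interpret direction_classes n p C
      by unfold_locales (auto simp: p_def C_def)
    have card: "n div R \<le> card (C t)" if "t < R" for t
      unfolding C_def using that by (rule card_residue_class_ge)
    have card_Diff: "n div R - 3 \<le> card (C t - {k, i, l})" if "t < R" for t k i l
    proof -
      have "card (C t) - card {k, i, l} \<le> card (C t - {k, i, l})" by (intro diff_card_le_card_Diff) simp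
      moreover have "card {k, i, l} \<le> 3" by (simp add: card_insert_if)
      ultimately show ?thesis using card[OF that] by linarith
    qed
    have g: "1 \<le> g" "g \<le> real (n div R - 1) * p\<^sup>2 / 2"
    proof -
      show "1 \<le> g" unfolding g_def using elim(3) \<epsilon>(1) by (intro ge_one_powr_ge_zero) auto
      have "real n / real R - 2 \<le> real (n div R - 1)"
        using real_le_div[OF R(1), of n] by linarith
      then show "g \<le> real (n div R - 1) * p\<^sup>2 / 2"
        using elim(1) unfolding g_def p_def
        by (meson divide_right_mono mult_right_mono order_trans zero_le_numeral zero_le_power2)
    qed
    have m: "n div R - 1 \<le> card (C t - {i})" if "t \<le> T" for t i
    proof -
      have "card (C t) - 1 \<le> card (C t - {i})" using diff_card_le_card_Diff[of "{i}" "C t"] by simp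
      then show ?thesis using card[of t] that by (simp add: R_def N_def)
    qed
    have "p * g ^ T = real n powr (\<epsilon> * T - \<alpha>)"
      using elim(3) by (simp add: p_def g_def powr_realpow[symmetric] powr_powr powr_add[symmetric])
    also have "1 \<le> real n powr (\<epsilon> * T - \<alpha>)"
      using elim(3) T by (intro ge_one_powr_ge_zero) auto
    finally have "1/2 \<le> p * g ^ T" by simp
    then have good: "P {S. \<not> good C i N u S} \<le> exp (- g)"
      if "u \<in> hc_vertices n" "i < n" for u i
      unfolding N_def using P_not_good_le[OF m g _ that] by simp
    have small: "real n * exp (- g) \<le> (1/4) ^ R" "3 * exp (- g) \<le> (1/4) ^ R"
    proof -
      show "real n * exp (- g) \<le> (1/4) ^ R" using elim(2) by (simp add: g_def)
      \<comment> \<open>As \<open>3 \<le> n\<close>, the bound for anchors also serves for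
        bridges.\<close>
      moreover have "3 * exp (- g) \<le> real n * exp (- g)" using elim(3) by (intro mult_right_mono) auto
      ultimately show "3 * exp (- g) \<le> (1/4) ^ R" by linarith
    qed
    have "1 - 2 ^ n * (1 + real n ^ 3) * (4 ^ (4 * R) * (1/4) ^ n)
        \<le> P {S. hc_distortion n S < ereal (3 * real (5 * (2 * N + 1)) + 1)}"
    proof (rule P_hc_distortion_less_ge[OF good])
      have "n div R - 3 \<le> card (C (Suc N))" using card[of "Suc N"] by (simp add: R_def)
      then show "(n * exp (- g)) ^ card (C (Suc N)) \<le> 4 ^ (4 * R) * (1/4) ^ n"
        using small R by (intro quarter_power_le) auto
      show "(3 * exp (- g)) ^ card (C N - {k, i, l}) \<le> 4 ^ (4 * R) * (1/4) ^ n" for k i l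
        using small R by (intro quarter_power_le card_Diff) (auto simp: R_def)
    qed (use elim(3) in auto)
    moreover have "2 ^ n * (1 + real n ^ 3) * (4 ^ (4 * R) * (1/4) ^ n)
        = 4 ^ (4 * R) * ((1 + real n ^ 3) * (1/2) ^ n)"
    proof -
      have "2 ^ n * (1 + real n ^ 3) * (4 ^ (4 * R) * (1/4) ^ n)
          = 4 ^ (4 * R) * ((1 + real n ^ 3) * (2 ^ n * (1/4) ^ n))" by (simp add: mult_ac)
      also have "(2 :: real) ^ n * (1/4) ^ n = (1/2) ^ n" by (simp flip: power_mult_distrib)
      finally show ?thesis .
    qed
    ultimately show ?case
      by (simp only: lower_def perc_prob_eq_bern c_def p_def)
  qed
  have up: "\<forall>\<^sub>F n in sequentially.
      perc_prob n (real n powr (- \<alpha>)) {S. hc_distortion n S < ereal c} \<le> 1"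
    using eventually_ge_at_top[of 1]
  proof eventually_elim
    case (elim n)
    then have "real n powr (- \<alpha>) \<le> 1" using assms by (simp add: powr_minus inverse_le_1_iff ge_one_powr_ge_zero)
    then show ?case unfolding perc_prob_eq_bern by (intro bern_le_1 finite_edges) auto
  qed
  \<comment> \<open>The union bound costs \<open>2 ^ n\<close> against \<open>(1/4) ^ n\<close>; the
    remaining \<open>(1/2) ^ n\<close> absorbs the polynomial.\<close>
  have "(\<lambda>n. (1 + real n ^ 3) * (1/2) ^ n) \<longlonglongrightarrow> 0" by real_asymp
  then have "lower \<longlonglongrightarrow> 1 - 4 ^ (4 * R) * 0"
    unfolding lower_def by (intro tendsto_intros)
  then have "lower \<longlonglongrightarrow> 1" by simp
  from tendsto_sandwich[OF low up this tendsto_const] show ?thesis by blast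
qed

end
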